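(* A ring $R$ is $\Delta U$ if and only if $R$ is $W\Delta U$ and $2\in\Delta(R)$.
   Context: Rings are associative with identity, not necessarily commutative. $U(R)$ is the group of units of $R$. $\Delta(R)=\{r\in R : r+u\in U(R)\text{ for all }u\in U(R)\}$; equivalently $\Delta(R)=J(T)$, where $T$ is the subring of $R$ generated by $U(R)$ and $J$ denotes the Jacobson radical. $R$ is $\Delta U$ if $U(R)=1+\Delta(R)$. $R$ is $W\Delta U$ if $U(R)=\pm 1+\Delta(R)$, i.e. every unit of $R$ has the form $1+d$ or $-1+d$ with $d\in\Delta(R)$. *)

theory Defs
  imports "HOL-Algebra.Ring"
begin

definition Delta :: "('a, 'b) ring_scheme \<Rightarrow> 'a set" where
  "Delta R = {r \<in> carrier R. \<forall>u \<in> Units R. r \<oplus>\<^bsub>R\<^esub> u \<in> Units R}"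

definition DeltaU :: "('a, 'b) ring_scheme \<Rightarrow> bool" where
  "DeltaU R \<longleftrightarrow> Units R = {\<one>\<^bsub>R\<^esub> \<oplus>\<^bsub>R\<^esub> d |d. d \<in> Delta R}"

definition WDeltaU :: "('a, 'b) ring_scheme \<Rightarrow> bool" where
  "WDeltaU R \<longleftrightarrow> Units R =
     {\<one>\<^bsub>R\<^esub> \<oplus>\<^bsub>R\<^esub> d |d. d \<in> Delta R} \<union>
     {\<ominus>\<^bsub>R\<^esub> \<one>\<^bsub>R\<^esub> \<oplus>\<^bsub>R\<^esub> d |d. d \<in> Delta R}"

end

theory Submission
  imports Defs
begin

text \<open>\<open>Delta R\<close> is closed under addition and negation. So if 2 lies in it, then
  -1 = 1 - 2 puts -1 + \<open>Delta R\<close> inside 1 + \<open>Delta R\<close>, and the union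
  defining \<open>WDeltaU\<close> collapses to the single coset defining \<open>DeltaU\<close>
  (\<open>minus_one_coset_Delta\<close>). Conversely, \<open>DeltaU\<close> forces 2 into
  \<open>Delta R\<close>, because the unit -1 must have the form 1 + d
  (\<open>DeltaU_imp_two_in_Delta\<close>).\<close>

context ring
begin

lemma Units_a_inv_closed:
  assumes "u \<in> Units R"
  shows "\<ominus> u \<in> Units R"
proof -
  have "\<ominus> \<one> \<otimes> u \<in> Units R"
    using assms by (intro Units_m_closed Units_minus_one_closed)
  then show ?thesis
    using assms by (simp add: l_minus Units_closed)
qed

lemma Delta_closed: "d \<in> Delta R \<Longrightarrow> d \<in> carrier R"
  by (simp add: Delta_def)

lemma Units_add_Delta: "u \<in> Units R \<Longrightarrow> d \<in> Delta R \<Longrightarrow> u \<oplus> d \<in> Units R"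
  by (auto simp: Delta_def a_comm Units_closed)

lemma Delta_add_closed:
  assumes "d \<in> Delta R" "e \<in> Delta R"
  shows "d \<oplus> e \<in> Delta R"
  using assms by (auto simp: Delta_def a_assoc Units_closed)

text \<open>Since -d + u = -(-u + d), the claim reduces to adding d to the unit -u, as units are
  stable under negation.\<close>

lemma Delta_a_inv_closed:
  assumes "d \<in> Delta R"
  shows "\<ominus> d \<in> Delta R"
  unfolding Delta_def
proof (intro CollectI conjI ballI)
  show "\<ominus> d \<in> carrier R"
    using assms by (simp add: Delta_closed)
  fix u assume u: "u \<in> Units R"
  have "\<ominus> (\<ominus> u \<oplus> d) \<in> Units R"
    using assms u by (intro Units_a_inv_closed Units_add_Delta)
  then show "\<ominus> d \<oplus> u \<in> Units R"
    using assms u by (simp add: minus_add Delta_closed Units_closed a_comm)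
qed

lemma minus_one_coset_Delta:
  assumes "\<one> \<oplus> \<one> \<in> Delta R"
  shows "{\<ominus> \<one> \<oplus> d |d. d \<in> Delta R} \<subseteq> {\<one> \<oplus> d |d. d \<in> Delta R}"
proof clarify
  fix d assume d: "d \<in> Delta R"
  \<comment> \<open>The shift by -2 moves the coset of -1 to that of 1; the new representative -2 +
    d stays in \<open>Delta R\<close>.\<close>
  have "\<ominus> \<one> \<oplus> d = \<one> \<oplus> (\<ominus> (\<one> \<oplus> \<one>) \<oplus> d)"
    using d by (simp add: Delta_closed minus_add a_assoc r_neg2)
  moreover have "\<ominus> (\<one> \<oplus> \<one>) \<oplus> d \<in> Delta R"
    using assms d by (blast intro: Delta_add_closed Delta_a_inv_closed)
  ultimately show "\<exists>e. \<ominus> \<one> \<oplus> d = \<one> \<oplus> e \<and> e \<in> Delta R"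
    by blast
qed

lemma DeltaU_imp_two_in_Delta:
  assumes "DeltaU R"
  shows "\<one> \<oplus> \<one> \<in> Delta R"
proof -
  obtain d where d: "d \<in> Delta R" "\<ominus> \<one> = \<one> \<oplus> d"
    using assms Units_minus_one_closed unfolding DeltaU_def by blast
  \<comment> \<open>Only one of the two copies of -1 is then replaced by 1 + d, so that the other
    cancels the 1 and leaves 2 = -d.\<close>
  have "\<one> \<oplus> \<one> = \<ominus> (\<ominus> \<one> \<oplus> \<ominus> \<one>)"
    by (simp add: minus_add)
  also have "\<dots> = \<ominus> (\<ominus> \<one> \<oplus> (\<one> \<oplus> d))"
    using d(2) by simp
  also have "\<dots> = \<ominus> d"
    using d(1) by (simp add: Delta_closed r_neg1)
  finally show ?thesis
    using d(1) by (simp add: Delta_a_inv_closed)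
qed

end

theorem proposition2p21:
  fixes R :: "('a, 'b) ring_scheme"
  assumes "ring R"
  shows "DeltaU R \<longleftrightarrow> WDeltaU R \<and> \<one>\<^bsub>R\<^esub> \<oplus>\<^bsub>R\<^esub> \<one>\<^bsub>R\<^esub> \<in> Delta R"
proof -
  interpret ring R by fact
  \<comment> \<open>Once 2 is in \<open>Delta R\<close>, the two definitions equate
    \<open>Units R\<close> with the same set. Both directions of the theorem follow, as
    \<open>DeltaU\<close> itself supplies this condition.\<close>
  have "DeltaU R \<longleftrightarrow> WDeltaU R" if "\<one>\<^bsub>R\<^esub> \<oplus>\<^bsub>R\<^esub> \<one>\<^bsub>R\<^esub> \<in> Delta R"
    using minus_one_coset_Delta[OF that] unfolding DeltaU_def WDeltaU_def
    by (simp add: Un_absorb2)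
  then show ?thesis
    using DeltaU_imp_two_in_Delta by blast
qed

end
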